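(* There is an algorithm which, given a finite graph $G$, computes an R-cocore of $G$ in time polynomial in the number of vertices of $G$.
   Context: Graphs are finite and undirected, with loops allowed: $G=(V_G,E_G)$ with $E_G\subseteq V_G\times V_G$ symmetric. For a graph $G$, a finite set $B$ and a relation $R\subseteq V_G\times B$ with full image (for every $b\in B$ there is $v\in V_G$ with $(v,b)\in R$), $G\ast R$ is the graph with vertex set $B$ and edge set $\{(u,v)\in B\times B : \text{there is } (x,y)\in E_G \text{ with } (x,u),(y,v)\in R\}$. The equation $H\ast R=G$ means that $R\subseteq V_H\times V_G$ has full image and $H\ast R$ equals $G$ as a graph. Let $H$ be an induced subgraph of $G$. An R-coretraction of $H$ to $G$ is a relation $R\subseteq V_H\times V_G$ such that $H\ast R=G$ and $(x,x)\in R$ for all $x\in V_H$; if one exists, $H$ is called an R-coretract of $G$. An R-coretract $H$ of $G$ is an R-cocore of $G$ if $H$ has no proper induced subgraph that is an R-coretract of $H$. *)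

theory Defs
  imports "Graph_Theory.Pair_Digraph" "Graph_Theory.Digraph_Component"
    "HOL-Computational_Algebra.Polynomial"
begin

section \<open>Relations between graphs\<close>

text \<open>
  A finite undirected graph with loops allowed is a record satisfying
  \<^locale>\<open>pair_pseudo_graph\<close>: a finite vertex set together with a symmetric set of pairs of vertices.
\<close>

definition rel_mult :: "'a pair_pre_digraph \<Rightarrow> ('a \<times> 'b) set \<Rightarrow> 'b set \<Rightarrow> 'b pair_pre_digraph" where
  "rel_mult G R B =
     \<lparr> pverts = B,
       parcs = {(u, v) \<in> B \<times> B. \<exists>(x, y) \<in> parcs G. (x, u) \<in> R \<and> (y, v) \<in> R} \<rparr>"

definition has_full_image :: "'a set \<Rightarrow> ('a \<times> 'b) set \<Rightarrow> 'b set \<Rightarrow> bool" where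
  "has_full_image A R B \<longleftrightarrow> (\<forall>b\<in>B. \<exists>a\<in>A. (a, b) \<in> R)"

text \<open>The equation \<open>H * R = G\<close>, including its side conditions on \<open>R\<close>.\<close>

definition rel_eq :: "'a pair_pre_digraph \<Rightarrow> ('a \<times> 'b) set \<Rightarrow> 'b pair_pre_digraph \<Rightarrow> bool" where
  "rel_eq H R G \<longleftrightarrow>
     R \<subseteq> pverts H \<times> pverts G \<and>
     has_full_image (pverts H) R (pverts G) \<and>
     rel_mult H R (pverts G) = G"

definition R_coretraction ::
    "'a pair_pre_digraph \<Rightarrow> 'a pair_pre_digraph \<Rightarrow> ('a \<times> 'a) set \<Rightarrow> bool" where
  "R_coretraction H G R \<longleftrightarrow>
     induced_subgraph (with_proj H) (with_proj G) \<and>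
     rel_eq H R G \<and>
     (\<forall>x\<in>pverts H. (x, x) \<in> R)"

definition R_coretract :: "'a pair_pre_digraph \<Rightarrow> 'a pair_pre_digraph \<Rightarrow> bool" where
  "R_coretract H G \<longleftrightarrow> (\<exists>R. R_coretraction H G R)"

definition R_cocore :: "'a pair_pre_digraph \<Rightarrow> 'a pair_pre_digraph \<Rightarrow> bool" where
  "R_cocore H G \<longleftrightarrow>
     R_coretract H G \<and>
     \<not> (\<exists>K. induced_subgraph (with_proj K) (with_proj H) \<and> K \<noteq> H \<and> R_coretract K H)"


section \<open>Random access machines\<close>

text \<open>
  The random access machine of Cook and Reckhow (Time bounded random access machines, 1973), over
  natural numbers with truncated subtraction. It has registers \<open>X 0, X 1, \<dots>\<close>, all initially \<open>0\<close>,
  a read-once input sequence and a write-only output sequence. The only arithmetic operations are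
  addition and subtraction, so one step at most doubles the largest number in use. Numbers of
  \<open>t\<close>-step computations therefore have a number of bits that is linear in \<open>t\<close> plus the number
  of bits of the largest input entry, and counting every instruction as one step
  is polynomially equivalent to time on Turing machines.
\<close>

datatype instr =
    Const nat nat       \<comment> \<open>\<open>Const i c\<close>: \<open>X i := c\<close>\<close>
  | Add nat nat nat     \<comment> \<open>\<open>Add i j k\<close>: \<open>X i := X j + X k\<close>\<close>
  | Sub nat nat nat     \<comment> \<open>\<open>Sub i j k\<close>: \<open>X i := X j - X k\<close>\<close>
  | Load nat nat        \<comment> \<open>\<open>Load i j\<close>: \<open>X i := X (X j)\<close>\<close>
  | Store nat nat       \<comment> \<open>\<open>Store i j\<close>: \<open>X (X i) := X j\<close>\<close>
  | JumpPos nat nat     \<comment> \<open>\<open>JumpPos l j\<close>: go to instruction \<open>l\<close> if \<open>X j > 0\<close>\<close>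
  | Read nat            \<comment> \<open>\<open>Read i\<close>: move the next input entry to \<open>X i\<close> (\<open>0\<close> if there is none)\<close>
  | Print nat           \<comment> \<open>\<open>Print j\<close>: append \<open>X j\<close> to the output\<close>

record config =
  pc :: nat
  regs :: "nat \<Rightarrow> nat"
  inp :: "nat list"
  outp :: "nat list"

definition init_config :: "nat list \<Rightarrow> config" where
  "init_config xs = \<lparr> pc = 0, regs = (\<lambda>_. 0), inp = xs, outp = [] \<rparr>"

fun exec_instr :: "instr \<Rightarrow> config \<Rightarrow> config" where
  "exec_instr (Const i c) s = s\<lparr> pc := Suc (pc s), regs := (regs s)(i := c) \<rparr>"
| "exec_instr (Add i j k) s =
     s\<lparr> pc := Suc (pc s), regs := (regs s)(i := regs s j + regs s k) \<rparr>"
| "exec_instr (Sub i j k) s =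
     s\<lparr> pc := Suc (pc s), regs := (regs s)(i := regs s j - regs s k) \<rparr>"
| "exec_instr (Load i j) s =
     s\<lparr> pc := Suc (pc s), regs := (regs s)(i := regs s (regs s j)) \<rparr>"
| "exec_instr (Store i j) s =
     s\<lparr> pc := Suc (pc s), regs := (regs s)(regs s i := regs s j) \<rparr>"
| "exec_instr (JumpPos l j) s = s\<lparr> pc := (if regs s j > 0 then l else Suc (pc s)) \<rparr>"
| "exec_instr (Read i) s =
     s\<lparr> pc := Suc (pc s),
        regs := (regs s)(i := (case inp s of [] \<Rightarrow> 0 | x # _ \<Rightarrow> x)),
        inp := tl (inp s) \<rparr>"
| "exec_instr (Print j) s = s\<lparr> pc := Suc (pc s), outp := outp s @ [regs s j] \<rparr>"

definition halted :: "instr list \<Rightarrow> config \<Rightarrow> bool" where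
  "halted P s \<longleftrightarrow> length P \<le> pc s"

definition step :: "instr list \<Rightarrow> config \<Rightarrow> config" where
  "step P s = (if halted P s then s else exec_instr (P ! pc s) s)"

text \<open>
  Halted configurations are fixed points of \<open>step\<close>, so being halted after \<open>t\<close>
  iterations means having halted after at most \<open>t\<close> steps.
\<close>

definition computes_within :: "instr list \<Rightarrow> nat list \<Rightarrow> nat list \<Rightarrow> nat \<Rightarrow> bool" where
  "computes_within P xs ys t \<longleftrightarrow>
     (let s = (step P ^^ t) (init_config xs) in halted P s \<and> outp s = ys)"


section \<open>Graphs as inputs and outputs\<close>

text \<open>
  With respect to an enumeration \<open>vs\<close> of its vertices, a graph is presented as an input by the number
  of vertices followed by the rows of its adjacency matrix. An induced subgraph is determined by its
  vertex set, so it is presented as an output by its 0/1 membership vector.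
\<close>

definition encode_graph :: "'a list \<Rightarrow> 'a pair_pre_digraph \<Rightarrow> nat list" where
  "encode_graph vs G =
     length vs # concat (map (\<lambda>u. map (\<lambda>v. if (u, v) \<in> parcs G then 1 else 0) vs) vs)"

definition encode_vertices :: "'a list \<Rightarrow> 'a pair_pre_digraph \<Rightarrow> nat list" where
  "encode_vertices vs H = map (\<lambda>v. if v \<in> pverts H then 1 else 0) vs"

end

(*
  Write N(u) for the neighbourhood of u. An induced subgraph H is an R-coretract of G iff every N(u)
  is a nonempty union of sets N(x) with x in H. Hence the vertices u for which N(u) is not a nonempty
  union of neighbourhoods that are strictly smaller, or equal but of an earlier vertex, induce an
  R-cocore: by induction along this well-founded order they generate all neighbourhoods, and none
  of them is generated by the others. Whether u is such a vertex is decided by four nested loops over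
  the vertices, with truncated subtraction in place of branching.
*)
theory Submission
  imports Defs
begin

section \<open>R-coretracts and generation of neighbourhoods\<close>

text \<open>A pair \<open>(x, u)\<close> of a coretraction forces N(x) to lie inside N(u), since
  every vertex of H is related to itself. Inclusion of neighbourhoods is thus the largest candidate
  relation, and the existence of a coretraction becomes a covering condition. The union has to be
  nonempty because of the full image: a vertex u with empty N(u) still needs a partner in H whose
  neighbourhood is empty. The obstacle is minimality: an R-cocore is tested by neighbourhoods inside
  H, whereas the kept vertices are selected by neighbourhoods in G. It is overcome because an
  R-coretract has, between its vertices, exactly the inclusions of neighbourhoods that G has. The
  tie-break is forced by vertices with equal neighbourhoods. They generate each other, so strict
  inclusion alone would keep all of an irreducible class, and plain inclusion between distinct
  vertices would drop all of it; exactly one should stay.\<close>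

definition nbh_generated :: "('a \<times> 'a) set \<Rightarrow> 'a set \<Rightarrow> 'a \<Rightarrow> bool" where
  "nbh_generated E S u \<longleftrightarrow>
     (\<exists>x\<in>S. E `` {x} \<subseteq> E `` {u}) \<and>
     (\<forall>v \<in> E `` {u}. \<exists>x\<in>S. E `` {x} \<subseteq> E `` {u} \<and> v \<in> E `` {x})"

lemma nbh_generated_mono: "nbh_generated E S u \<Longrightarrow> S \<subseteq> T \<Longrightarrow> nbh_generated E T u"
  unfolding nbh_generated_def by blast

lemma nbh_generated_self: "u \<in> S \<Longrightarrow> nbh_generated E S u"
  unfolding nbh_generated_def by blast

text \<open>Each generator is replaced by its own generators. Only generators with neighbourhood
  inside N(u) have to be replaceable; the irredundance argument uses this inclusion to place them
  before u.\<close>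

lemma nbh_generated_trans:
  assumes "nbh_generated E S u"
    and "\<And>x. x \<in> S \<Longrightarrow> E `` {x} \<subseteq> E `` {u} \<Longrightarrow> nbh_generated E T x"
  shows "nbh_generated E T u"
  unfolding nbh_generated_def
proof (intro conjI ballI)
  obtain x where x: "x \<in> S" "E `` {x} \<subseteq> E `` {u}"
    using assms(1) unfolding nbh_generated_def by blast
  from assms(2)[OF this] obtain y where "y \<in> T" "E `` {y} \<subseteq> E `` {x}"
    unfolding nbh_generated_def by blast
  with x show "\<exists>x\<in>T. E `` {x} \<subseteq> E `` {u}" by blast
next
  fix v assume "v \<in> E `` {u}"
  then obtain x where x: "x \<in> S" "E `` {x} \<subseteq> E `` {u}" "v \<in> E `` {x}"
    using assms(1) unfolding nbh_generated_def by blast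
  from assms(2)[OF x(1,2)] x(3) obtain y where "y \<in> T" "E `` {y} \<subseteq> E `` {x}" "v \<in> E `` {y}"
    unfolding nbh_generated_def by blast
  with x show "\<exists>x\<in>T. E `` {x} \<subseteq> E `` {u} \<and> v \<in> E `` {x}" by blast
qed

section \<open>Symmetric digraphs and their induced subgraphs\<close>

lemma pair_sym_digraph_symD: "pair_sym_digraph G \<Longrightarrow> (x, y) \<in> parcs G \<Longrightarrow> (y, x) \<in> parcs G"
  by (metis pair_sym_digraph.pair_sym_arcs symD symmetric_def with_proj_simps(3))

lemma pair_sym_digraph_arcD:
  assumes "pair_sym_digraph G" "(x, y) \<in> parcs G"
  shows "x \<in> pverts G" "y \<in> pverts G"
proof -
  interpret pair_sym_digraph G by fact
  show "x \<in> pverts G" "y \<in> pverts G" using assms(2) by (auto dest: in_arcsD1 in_arcsD2)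
qed

lemma induced_subgraph_with_proj_iff:
  assumes "pair_sym_digraph G"
  shows "induced_subgraph (with_proj H) (with_proj G) \<longleftrightarrow>
         pverts H \<subseteq> pverts G \<and> parcs H = parcs G \<inter> pverts H \<times> pverts H"
proof -
  interpret pair_sym_digraph G by fact
  have "wf_digraph (with_proj G)" by unfold_locales
  moreover have "wf_digraph (with_proj H)" if "parcs H \<subseteq> pverts H \<times> pverts H"
    using that by (intro wf_digraph.intro) auto
  ultimately show ?thesis
    unfolding induced_subgraph_def subgraph_def compatible_def with_proj_simps by auto
qed

lemma pair_sym_digraph_induced:
  assumes "pair_sym_digraph G" "induced_subgraph (with_proj H) (with_proj G)"
  shows "pair_sym_digraph H"
proof -
  have H: "parcs H = parcs G \<inter> pverts H \<times> pverts H"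
    using assms by (simp add: induced_subgraph_with_proj_iff)
  have "sym (parcs H)"
    by (rule symI) (simp add: H pair_sym_digraph_symD[OF assms(1)])
  then have "symmetric (with_proj H)" by (simp add: symmetric_def)
  moreover have "fst e \<in> pverts H \<and> snd e \<in> pverts H" if "e \<in> parcs H" for e
    using that unfolding H by (simp add: mem_Times_iff)
  ultimately show ?thesis by unfold_locales blast+
qed

text \<open>A coretraction supplies the generators of N(u) as the vertices related to u. Conversely,
  inclusion of neighbourhoods is a coretraction: an edge of G is pulled back to H one end at a time,
  by symmetry.\<close>

lemma R_coretract_iff_nbh_generated:
  assumes G: "pair_sym_digraph G"
  shows "R_coretract H G \<longleftrightarrow> induced_subgraph (with_proj H) (with_proj G) \<and>
           (\<forall>u\<in>pverts G. nbh_generated (parcs G) (pverts H) u)"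
proof (intro iffI conjI ballI)
  note sym = pair_sym_digraph_symD[OF G] and arcD = pair_sym_digraph_arcD[OF G]
  {
    assume "R_coretract H G"
    then obtain R where R: "R_coretraction H G R" unfolding R_coretract_def ..
    then show "induced_subgraph (with_proj H) (with_proj G)" by (simp add: R_coretraction_def)
    then have H: "pverts H \<subseteq> pverts G" "parcs H = parcs G \<inter> pverts H \<times> pverts H"
      using G by (simp_all add: induced_subgraph_with_proj_iff)
    have refl: "(x, x) \<in> R" if "x \<in> pverts H" for x
      using R that by (simp add: R_coretraction_def)
    have R_sub: "R \<subseteq> pverts H \<times> pverts G" and full: "\<And>u. u \<in> pverts G \<Longrightarrow> \<exists>x. (x, u) \<in> R"
      and mult: "rel_mult H R (pverts G) = G"
      using R by (auto simp: R_coretraction_def rel_eq_def has_full_image_def)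
    have "parcs G = {(u, v) \<in> pverts G \<times> pverts G. \<exists>(x, y) \<in> parcs H. (x, u) \<in> R \<and> (y, v) \<in> R}"
      using arg_cong[OF mult, of parcs] by (simp add: rel_mult_def)
    then have arc_iff: "(u, v) \<in> parcs G \<longleftrightarrow> (\<exists>x y. (x, y) \<in> parcs H \<and> (x, u) \<in> R \<and> (y, v) \<in> R)"
      for u v
      using R_sub by blast
    have nbh_H: "(u, y) \<in> parcs G" if "(x, u) \<in> R" "(x, y) \<in> parcs H" for x u y
      using that arc_iff refl H(2) by blast
    have nbh_sub: "parcs G `` {x} \<subseteq> parcs G `` {u}" if xu: "(x, u) \<in> R" for x u
    proof
      fix v assume "v \<in> parcs G `` {x}"
      then obtain x' y where y: "(x', y) \<in> parcs H" "(x', x) \<in> R" "(y, v) \<in> R"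
        using arc_iff by blast
      \<comment> \<open>Both x and y lie in H, so this edge is an edge of the induced subgraph and
        can be pushed forward along \<open>(x, u)\<close> and \<open>(y, v)\<close>.\<close>
      have "(x, y) \<in> parcs G" using nbh_H y by blast
      then have "(x, y) \<in> parcs H" using H(2) xu y R_sub by blast
      then show "v \<in> parcs G `` {u}" using arc_iff xu y(3) by blast
    qed
    fix u assume u: "u \<in> pverts G"
    show "nbh_generated (parcs G) (pverts H) u"
      unfolding nbh_generated_def
    proof (intro conjI ballI)
      show "\<exists>x\<in>pverts H. parcs G `` {x} \<subseteq> parcs G `` {u}"
        using full[OF u] R_sub nbh_sub by blast
    next
      fix v assume "v \<in> parcs G `` {u}"
      then obtain x y where xy: "(x, y) \<in> parcs H" "(x, u) \<in> R" "(y, v) \<in> R"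
        using arc_iff by blast
      have "(x, v) \<in> parcs G"
        using arc_iff xy refl H(2) by blast
      then show "\<exists>x\<in>pverts H. parcs G `` {x} \<subseteq> parcs G `` {u} \<and> v \<in> parcs G `` {x}"
        using xy(2) nbh_sub R_sub by blast
    qed
  }
  {
    assume asm: "induced_subgraph (with_proj H) (with_proj G) \<and>
      (\<forall>u\<in>pverts G. nbh_generated (parcs G) (pverts H) u)"
    then have H: "pverts H \<subseteq> pverts G" "parcs H = parcs G \<inter> pverts H \<times> pverts H"
      using G by (simp_all add: induced_subgraph_with_proj_iff)
    define R where "R = {(x, u) \<in> pverts H \<times> pverts G. parcs G `` {x} \<subseteq> parcs G `` {u}}"
    have gen: "\<exists>x. (x, u) \<in> R \<and> (x, v) \<in> parcs G" if "(u, v) \<in> parcs G" for u v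
      using asm that arcD[OF that] unfolding nbh_generated_def R_def by blast
    have "(u, v) \<in> parcs G \<longleftrightarrow>
          u \<in> pverts G \<and> v \<in> pverts G \<and> (\<exists>(x, y)\<in>parcs H. (x, u) \<in> R \<and> (y, v) \<in> R)" for u v
    proof
      assume uv: "(u, v) \<in> parcs G"
      then obtain x where x: "(x, u) \<in> R" "(x, v) \<in> parcs G" using gen by blast
      \<comment> \<open>The first end is already moved to x in H; reading the edge from v to x,
        generation of N(v) now moves the other end.\<close>
      then obtain y where y: "(y, v) \<in> R" "(y, x) \<in> parcs G" using gen sym by blast
      have "(x, y) \<in> parcs H" using x y sym H(2) unfolding R_def by blast
      then show "u \<in> pverts G \<and> v \<in> pverts G \<and> (\<exists>(x, y)\<in>parcs H. (x, u) \<in> R \<and> (y, v) \<in> R)"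
        using x y arcD[OF uv] by blast
    next
      assume "u \<in> pverts G \<and> v \<in> pverts G \<and> (\<exists>(x, y)\<in>parcs H. (x, u) \<in> R \<and> (y, v) \<in> R)"
      then obtain x y where xy: "(x, y) \<in> parcs G" "(x, u) \<in> R" "(y, v) \<in> R" using H(2) by blast
      then have "(u, y) \<in> parcs G" unfolding R_def by blast
      then have "(y, u) \<in> parcs G" by (rule sym)
      then have "(v, u) \<in> parcs G" using xy(3) unfolding R_def by blast
      then show "(u, v) \<in> parcs G" by (rule sym)
    qed
    then have "rel_mult H R (pverts G) = G"
      unfolding rel_mult_def by (intro pair_pre_digraph.equality) auto
    moreover have "has_full_image (pverts H) R (pverts G)"
      using asm unfolding has_full_image_def R_def nbh_generated_def by blast
    moreover have "R \<subseteq> pverts H \<times> pverts G" "\<forall>x\<in>pverts H. (x, x) \<in> R"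
      using H(1) by (auto simp: R_def)
    ultimately have "R_coretraction H G R"
      using asm by (simp add: R_coretraction_def rel_eq_def)
    then show "R_coretract H G" unfolding R_coretract_def ..
  }
qed

text \<open>A neighbour v of x outside H has a substitute z in H that is adjacent to x and satisfies
  N(z) \<subseteq> N(v). If z is adjacent to y, then so is v, hence inclusions seen in H lift to
  G.\<close>

lemma R_coretract_nbh_subset_iff:
  assumes G: "pair_sym_digraph G" and H: "R_coretract H G"
    and xy: "x \<in> pverts H" "y \<in> pverts H"
  shows "parcs H `` {x} \<subseteq> parcs H `` {y} \<longleftrightarrow> parcs G `` {x} \<subseteq> parcs G `` {y}"
proof
  note sym = pair_sym_digraph_symD[OF G] and arcD = pair_sym_digraph_arcD[OF G]
  have ind: "parcs H = parcs G \<inter> pverts H \<times> pverts H"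
    and gen: "\<And>u. u \<in> pverts G \<Longrightarrow> nbh_generated (parcs G) (pverts H) u"
    using H by (simp_all add: R_coretract_iff_nbh_generated[OF G] induced_subgraph_with_proj_iff[OF G])
  show "parcs H `` {x} \<subseteq> parcs H `` {y}" if "parcs G `` {x} \<subseteq> parcs G `` {y}"
    using that xy ind by blast
  assume sub: "parcs H `` {x} \<subseteq> parcs H `` {y}"
  show "parcs G `` {x} \<subseteq> parcs G `` {y}"
  proof
    fix v assume v: "v \<in> parcs G `` {x}"
    then have "(v, x) \<in> parcs G" "v \<in> pverts G" using sym arcD by blast+
    then obtain z where z: "z \<in> pverts H" "parcs G `` {z} \<subseteq> parcs G `` {v}" "(z, x) \<in> parcs G"
      using gen[of v] unfolding nbh_generated_def by blast
    then have "z \<in> parcs H `` {y}" using sub ind sym xy by blast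
    then have "(z, y) \<in> parcs G" using ind sym by blast
    then show "v \<in> parcs G `` {y}" using z(2) sym by blast
  qed
qed

text \<open>A proper R-coretract K of H misses some vertex h, whose neighbourhood in H is then
  generated by K. This lifts to G: a neighbour v of h is replaced by z in H with N(z) \<subseteq>
  N(v), and whatever in K covers z also covers v.\<close>

lemma R_cocoreI:
  assumes G: "pair_sym_digraph G" and H: "R_coretract H G"
    and irredundant: "\<And>h. h \<in> pverts H \<Longrightarrow> \<not> nbh_generated (parcs G) (pverts H - {h}) h"
  shows "R_cocore H G"
  unfolding R_cocore_def
proof (intro conjI notI H; elim exE conjE)
  note sym = pair_sym_digraph_symD[OF G] and arcD = pair_sym_digraph_arcD[OF G]
  have indH: "induced_subgraph (with_proj H) (with_proj G)"
    and gen: "\<And>u. u \<in> pverts G \<Longrightarrow> nbh_generated (parcs G) (pverts H) u"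
    using H by (simp_all add: R_coretract_iff_nbh_generated[OF G])
  have arcsH: "pverts H \<subseteq> pverts G" "parcs H = parcs G \<inter> pverts H \<times> pverts H"
    using indH by (simp_all add: induced_subgraph_with_proj_iff[OF G])
  have symH: "pair_sym_digraph H" using pair_sym_digraph_induced[OF G indH] .
  fix K assume K: "induced_subgraph (with_proj K) (with_proj H)" "K \<noteq> H" "R_coretract K H"
  have arcsK: "pverts K \<subseteq> pverts H" "parcs K = parcs H \<inter> pverts K \<times> pverts K"
    using K(1) by (simp_all add: induced_subgraph_with_proj_iff[OF symH])
  have "pverts K \<noteq> pverts H"
  proof
    assume eq: "pverts K = pverts H"
    have "parcs K = parcs H" unfolding arcsK(2) eq using arcsH(2) by (metis Int_absorb Int_assoc)
    with eq show False using K(2) by simp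
  qed
  then obtain h where h: "h \<in> pverts H" "h \<notin> pverts K" using arcsK(1) by blast
  have "nbh_generated (parcs H) (pverts K) h"
    using K(3) h(1) by (simp add: R_coretract_iff_nbh_generated[OF symH])
  then have genK: "\<exists>x\<in>pverts K. parcs H `` {x} \<subseteq> parcs H `` {h}"
    "\<And>v. v \<in> parcs H `` {h} \<Longrightarrow>
      \<exists>x\<in>pverts K. parcs H `` {x} \<subseteq> parcs H `` {h} \<and> v \<in> parcs H `` {x}"
    unfolding nbh_generated_def by blast+
  have sub: "parcs G `` {x} \<subseteq> parcs G `` {h}"
    if "x \<in> pverts K" "parcs H `` {x} \<subseteq> parcs H `` {h}" for x
    using that R_coretract_nbh_subset_iff[OF G H _ h(1)] arcsK(1) by blast
  have "nbh_generated (parcs G) (pverts K) h"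
    unfolding nbh_generated_def
  proof (intro conjI ballI)
    show "\<exists>x\<in>pverts K. parcs G `` {x} \<subseteq> parcs G `` {h}" using genK(1) sub by blast
  next
    fix v assume "v \<in> parcs G `` {h}"
    then have "(v, h) \<in> parcs G" "v \<in> pverts G" using sym arcD by blast+
    then obtain z where z: "z \<in> pverts H" "parcs G `` {z} \<subseteq> parcs G `` {v}" "(z, h) \<in> parcs G"
      using gen[of v] unfolding nbh_generated_def by blast
    then have "z \<in> parcs H `` {h}" using arcsH(2) h(1) sym by blast
    then obtain x where x: "x \<in> pverts K" "parcs H `` {x} \<subseteq> parcs H `` {h}" "(x, z) \<in> parcs H"
      using genK(2) by blast
    then have "(v, x) \<in> parcs G" using z(2) arcsH(2) sym by blast
    then show "\<exists>x\<in>pverts K. parcs G `` {x} \<subseteq> parcs G `` {h} \<and> v \<in> parcs G `` {x}"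
      using x sub sym by blast
  qed
  moreover have "pverts K \<subseteq> pverts H - {h}" using arcsK(1) h(2) by blast
  ultimately have "nbh_generated (parcs G) (pverts H - {h}) h" by (rule nbh_generated_mono)
  with irredundant[OF h(1)] show False by contradiction
qed

section \<open>The irredundant vertices\<close>

definition nbh_before :: "('a \<times> 'a) set \<Rightarrow> ('a \<Rightarrow> nat) \<Rightarrow> 'a \<Rightarrow> 'a \<Rightarrow> bool" where
  "nbh_before E f x u \<longleftrightarrow> E `` {x} \<subseteq> E `` {u} \<and> (E `` {u} \<subseteq> E `` {x} \<longrightarrow> f x < f u)"

lemma R_cocore_irredundant:
  assumes G: "pair_pseudo_graph G" and inj: "inj_on f (pverts G)"
  defines "S \<equiv> {u \<in> pverts G. \<not> nbh_generated (parcs G) {x \<in> pverts G. nbh_before (parcs G) f x u} u}"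
  shows "R_cocore \<lparr>pverts = S, parcs = parcs G \<inter> S \<times> S\<rparr> G"
proof -
  interpret pair_pseudo_graph G by fact
  have sym: "pair_sym_digraph G" by unfold_locales
  let ?N = "\<lambda>u. parcs G `` {u}" and ?A = "\<lambda>u. {x \<in> pverts G. nbh_before (parcs G) f x u}"
  let ?H = "\<lparr>pverts = S, parcs = parcs G \<inter> S \<times> S\<rparr>"
  have fin: "finite (?N u)" for u using pair_finite_arcs by (rule finite_Image)
  have gen: "nbh_generated (parcs G) S u" if "u \<in> pverts G" for u
    using that
  \<comment> \<open>\<open>nbh_before\<close> decreases this lexicographic measure: a proper
    inclusion of finite neighbourhoods lowers the cardinality, and equality lowers
    \<open>f\<close>.\<close>
  proof (induction u rule: wf_induct_rule[OF wf_measures[of "[\<lambda>u. card (?N u), f]"]])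
    case (1 u)
    show ?case
    proof (cases "u \<in> S")
      case True
      then show ?thesis by (rule nbh_generated_self)
    next
      case False
      then have "nbh_generated (parcs G) (?A u) u" using 1(2) by (simp add: S_def)
      then show ?thesis
      proof (rule nbh_generated_trans)
        fix x assume x: "x \<in> ?A u"
        then consider "?N x \<subset> ?N u" | "?N x = ?N u" "f x < f u"
          unfolding nbh_before_def by blast
        then have "(x, u) \<in> measures [\<lambda>u. card (?N u), f]"
          by cases (simp_all add: psubset_card_mono[OF fin])
        then show "nbh_generated (parcs G) S x" using 1(1) x by blast
      qed
    qed
  qed
  have ind: "induced_subgraph (with_proj ?H) (with_proj G)"
    by (auto simp: induced_subgraph_with_proj_iff[OF sym] S_def)
  show ?thesis
  proof (rule R_cocoreI[OF sym])
    show "R_coretract ?H G" using gen ind by (simp add: R_coretract_iff_nbh_generated[OF sym])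
  next
    fix h assume "h \<in> pverts ?H"
    then have hS: "h \<in> S" by simp
    show "\<not> nbh_generated (parcs G) (pverts ?H - {h}) h"
    proof
      assume g: "nbh_generated (parcs G) (pverts ?H - {h}) h"
      have "nbh_generated (parcs G) (?A h) h"
        using g
      proof (rule nbh_generated_trans)
        fix x assume "x \<in> pverts ?H - {h}" and sub: "?N x \<subseteq> ?N h"
        then have x: "x \<in> S" "x \<noteq> h" by auto
        have "nbh_before (parcs G) f x h"
        \<comment> \<open>Otherwise x and h have equal neighbourhoods and h precedes x by
          injectivity of \<open>f\<close>. Then h alone generates N(x), so x would not have been
          kept.\<close>
        proof (rule ccontr)
          assume "\<not> nbh_before (parcs G) f x h"
          then have eq: "?N h = ?N x" and "f h \<le> f x" using sub by (auto simp: nbh_before_def)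
          then have "f h < f x" using inj x hS by (auto simp: S_def inj_on_def le_less)
          then have "nbh_before (parcs G) f h x" using eq by (simp add: nbh_before_def)
          then have "nbh_generated (parcs G) (?A x) x"
            using hS eq unfolding nbh_generated_def S_def by blast
          then show False using x by (simp add: S_def)
        qed
        then show "nbh_generated (parcs G) (?A h) x"
          using x by (intro nbh_generated_self) (simp add: S_def)
      qed
      then show False using hS by (simp add: S_def)
    qed
  qed
qed

section \<open>Hoare triples for random access machines\<close>

type_synonym asrt = "(nat \<Rightarrow> nat) \<Rightarrow> nat list \<Rightarrow> nat list \<Rightarrow> bool"

text \<open>Jump targets are absolute, so a piece of code depends on the address at which it is
  placed.\<close>

type_synonym code = "nat \<Rightarrow> instr list"

definition code_at :: "instr list \<Rightarrow> nat \<Rightarrow> instr list \<Rightarrow> bool" where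
  "code_at P l c \<longleftrightarrow> (\<exists>xs ys. P = xs @ c @ ys \<and> length xs = l)"

lemma code_at_Nil: "code_at P l [] \<longleftrightarrow> l \<le> length P"
proof
  assume "l \<le> length P"
  then show "code_at P l []"
    unfolding code_at_def by (intro exI[of _ "take l P"] exI[of _ "drop l P"]) simp
qed (auto simp: code_at_def)

lemma code_at_append:
  "code_at P l (c @ d) \<longleftrightarrow> code_at P l c \<and> code_at P (l + length c) d"
proof
  assume "code_at P l (c @ d)"
  then obtain xs ys where "P = xs @ (c @ d) @ ys" "length xs = l" unfolding code_at_def by blast
  then have "P = xs @ c @ (d @ ys)" "P = (xs @ c) @ d @ ys" "length (xs @ c) = l + length c" by auto
  then show "code_at P l c \<and> code_at P (l + length c) d"
    using \<open>length xs = l\<close> unfolding code_at_def by blast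
next
  assume "code_at P l c \<and> code_at P (l + length c) d"
  then obtain xs ys xs' ys' where
    P: "P = xs @ c @ ys" "length xs = l" "P = xs' @ d @ ys'" "length xs' = l + length c"
    unfolding code_at_def by blast
  then have "xs' = xs @ c" by (metis append.assoc append_eq_append_conv length_append)
  then show "code_at P l (c @ d)" using P unfolding code_at_def by auto
qed

lemma code_at_Cons:
  "code_at P l (i # c) \<longleftrightarrow> l < length P \<and> P ! l = i \<and> code_at P (Suc l) c"
proof -
  have "code_at P l [i] \<longleftrightarrow> l < length P \<and> P ! l = i"
  proof
    show "code_at P l [i] \<Longrightarrow> l < length P \<and> P ! l = i"
      by (auto simp: code_at_def nth_append)
    show "l < length P \<and> P ! l = i \<Longrightarrow> code_at P l [i]"
      unfolding code_at_def
      by (rule exI[of _ "take l P"], rule exI[of _ "drop (Suc l) P"]) (auto simp: id_take_nth_drop)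
  qed
  then show ?thesis using code_at_append[of P l "[i]" c] by simp
qed

text \<open>Total correctness with a step bound, inside any program that contains the code at the
  current address; control ends just behind the code, which makes triples composable.\<close>

definition triple :: "asrt \<Rightarrow> code \<Rightarrow> nat \<Rightarrow> asrt \<Rightarrow> bool" where
  "triple A f k B \<longleftrightarrow>
     (\<forall>P s. code_at P (pc s) (f (pc s)) \<and> A (regs s) (inp s) (outp s) \<longrightarrow>
        (\<exists>m\<le>k. \<exists>t. (step P ^^ m) s = t \<and> pc t = pc s + length (f (pc s)) \<and>
           B (regs t) (inp t) (outp t)))"

lemma tripleE:
  assumes "triple A f k B" "code_at P (pc s) (f (pc s))" "A (regs s) (inp s) (outp s)"
  obtains m t where "m \<le> k" "(step P ^^ m) s = t" "pc t = pc s + length (f (pc s))"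
    "B (regs t) (inp t) (outp t)"
  using assms unfolding triple_def by blast

lemma triple_conseq:
  assumes "triple A f k B" "k \<le> k'"
    and "\<And>r xs ys. A' r xs ys \<Longrightarrow> A r xs ys" "\<And>r xs ys. B r xs ys \<Longrightarrow> B' r xs ys"
  shows "triple A' f k' B'"
  using assms unfolding triple_def by (meson order_trans)

definition seq :: "code \<Rightarrow> code \<Rightarrow> code" where
  "seq f g l = f l @ g (l + length (f l))"

lemma triple_seq:
  assumes "triple A f k B" "triple B g m C"
  shows "triple A (seq f g) (k + m) C"
  unfolding triple_def
proof (intro allI impI, elim conjE)
  fix P and s :: config assume "code_at P (pc s) (seq f g (pc s))" and A: "A (regs s) (inp s) (outp s)"
  then have f: "code_at P (pc s) (f (pc s))"
    and g: "code_at P (pc s + length (f (pc s))) (g (pc s + length (f (pc s))))"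
    by (simp_all add: seq_def code_at_append)
  obtain i t where t: "i \<le> k" "(step P ^^ i) s = t" "pc t = pc s + length (f (pc s))"
    "B (regs t) (inp t) (outp t)"
    using tripleE[OF assms(1) f A] by blast
  obtain j u where u: "j \<le> m" "(step P ^^ j) t = u" "pc u = pc t + length (g (pc t))"
    "C (regs u) (inp u) (outp u)"
    using tripleE[OF assms(2) _ t(4)] g t(3) by metis
  have "(step P ^^ (j + i)) s = u" using t u by (simp add: funpow_add)
  then show "\<exists>m'\<le>k + m. \<exists>t. (step P ^^ m') s = t \<and> pc t = pc s + length (seq f g (pc s)) \<and>
           C (regs t) (inp t) (outp t)"
    using t u by (intro exI[of _ "j + i"]) (auto simp: seq_def)
qed

fun is_jump :: "instr \<Rightarrow> bool" where
  "is_jump (JumpPos l j) = True"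
| "is_jump _ = False"

lemma pc_exec_instr: "\<not> is_jump i \<Longrightarrow> pc (exec_instr i s) = Suc (pc s)"
  by (cases i) auto

lemma step_code_at: "code_at P (pc s) (i # c) \<Longrightarrow> step P s = exec_instr i s"
  by (auto simp: code_at_Cons step_def halted_def)

lemma funpow_step_block:
  assumes "code_at P (pc s) c" "\<forall>i\<in>set c. \<not> is_jump i"
  shows "(step P ^^ length c) s = fold exec_instr c s \<and> pc (fold exec_instr c s) = pc s + length c"
  using assms
proof (induction c arbitrary: s)
  case (Cons i c)
  then have "code_at P (pc (exec_instr i s)) c" by (simp add: pc_exec_instr code_at_Cons)
  from Cons.IH[OF this] Cons.prems show ?case
    by (simp add: funpow_swap1[symmetric] funpow_Suc_right step_code_at pc_exec_instr
        del: funpow.simps)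
qed simp

definition block :: "instr list \<Rightarrow> code" where
  "block c l = c"

text \<open>Straight-line code is verified by symbolic execution: the simplifier unfolds
  \<open>fold exec_instr c s\<close>.\<close>

lemma triple_block:
  assumes "\<forall>i\<in>set c. \<not> is_jump i"
    and "\<And>s. A (regs s) (inp s) (outp s) \<Longrightarrow>
           (let t = fold exec_instr c s in B (regs t) (inp t) (outp t))"
    and "k = length c"
  shows "triple A (block c) k B"
  unfolding triple_def block_def
  using funpow_step_block[OF _ assms(1)] assms(2,3) by (metis order_refl)

text \<open>Register 0 is meant to hold 0, register 1 to hold 1 and register 2 the number of iterations,
  which must be positive because the counter is tested only after the body.\<close>

definition for_loop :: "nat \<Rightarrow> code \<Rightarrow> code" where
  "for_loop c f l = Add c 2 0 # f (Suc l) @ [Sub c c 1, JumpPos (Suc l) c]"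

text \<open>The counter is kept out of the invariant \<open>I\<close> (assumption
  \<open>upd\<close>), so that resetting and decrementing it preserve \<open>I\<close>; its value
  \<open>n - i\<close> is carried separately through the body. The cost is one step for the
  initialisation and, per round, two beyond the body.\<close>

lemma triple_for_loop:
  assumes "n > 0"
    and body: "\<And>i. i < n \<Longrightarrow> triple (\<lambda>r xs ys. I i r xs ys \<and> r c = n - i) f k
                                     (\<lambda>r xs ys. I (Suc i) r xs ys \<and> r c = n - i)"
    and upd: "\<And>i r x xs ys. I i r xs ys \<Longrightarrow> I i (r(c := x)) xs ys"
    and fixed: "\<And>i r xs ys. I i r xs ys \<Longrightarrow> r 0 = 0 \<and> r 1 = 1 \<and> r 2 = n"
    and c: "2 < c"
  shows "triple (I 0) (for_loop c f) (Suc (n * (k + 2))) (I n)"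
  unfolding triple_def
proof (intro allI impI, elim conjE)
  fix P and s :: config assume code: "code_at P (pc s) (for_loop c f (pc s))" and A: "I 0 (regs s) (inp s) (outp s)"
  let ?l = "Suc (pc s)" let ?e = "?l + length (f ?l)"
  have init: "code_at P (pc s) [Add c 2 0]" and codef: "code_at P ?l (f ?l)"
    and tail: "code_at P ?e [Sub c c 1, JumpPos ?l c]"
    using code by (simp_all add: for_loop_def code_at_Cons code_at_append code_at_Nil Suc_le_eq)
  have loop: "\<exists>m\<le>(n - i) * (k + 2). \<exists>u. (step P ^^ m) t = u \<and> pc u = ?e + 2 \<and> I n (regs u) (inp u) (outp u)"
    if "i < n" "pc t = ?l" "I i (regs t) (inp t) (outp t)" "regs t c = n - i" for i and t :: config
    using that
  proof (induction "n - i" arbitrary: i t)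
    case (Suc d)
    have "code_at P (pc t) (f (pc t))" "I i (regs t) (inp t) (outp t) \<and> regs t c = n - i"
      using codef Suc.prems by simp_all
    from tripleE[OF body[OF Suc.prems(1)] this]
    obtain m u where u: "m \<le> k" "(step P ^^ m) t = u" "pc u = pc t + length (f (pc t))"
      "I (Suc i) (regs u) (inp u) (outp u)" "regs u c = n - i" by blast
    have u_pc: "pc u = ?e" using u(3) Suc.prems(2) by simp
    define v where "v = step P (step P u)"
    have u1: "regs u 1 = 1" using fixed[OF u(4)] by simp
    have "step P u = exec_instr (Sub c c 1) u"
      using step_code_at tail u_pc by metis
    moreover have "step P (exec_instr (Sub c c 1) u)
        = exec_instr (JumpPos ?l c) (exec_instr (Sub c c 1) u)"
      by (rule step_code_at[where c = "[]"]) (use tail u_pc in \<open>simp add: code_at_Cons\<close>)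
    ultimately have v: "regs v = (regs u)(c := n - Suc i)" "inp v = inp u" "outp v = outp u"
      "pc v = (if n - Suc i > 0 then ?l else ?e + 2)"
      using u u_pc u1 by (simp_all add: v_def)
    have Iv: "I (Suc i) (regs v) (inp v) (outp v)" using upd[OF u(4)] v by simp
    have tv: "(step P ^^ (2 + m)) t = v" using u(2) by (simp add: funpow_add v_def numeral_2_eq_2)
    have fuel: "2 + m + (n - Suc i) * (k + 2) \<le> (n - i) * (k + 2)"
      using u(1) Suc.prems(1) by (simp add: Suc_diff_Suc[symmetric])
    show ?case
    proof (cases "Suc i < n")
      case True
      have d: "d = n - Suc i" using Suc.hyps(2) by simp
      obtain m' w where w: "m' \<le> (n - Suc i) * (k + 2)" "(step P ^^ m') v = w" "pc w = ?e + 2"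
        "I n (regs w) (inp w) (outp w)"
        using Suc.hyps(1)[OF d True _ Iv] v True by auto
      have "(step P ^^ (m' + (2 + m))) t = w" using tv w(2) by (simp only: funpow_add comp_apply)
      moreover have "m' + (2 + m) \<le> (n - i) * (k + 2)" using w(1) fuel by linarith
      ultimately show ?thesis using w(3,4) by blast
    next
      case False
      then have "Suc i = n" using Suc.prems(1) by simp
      then show ?thesis using tv v Iv fuel by (intro exI[of _ "2 + m"]) auto
    qed
  qed simp
  define t where "t = step P s"
  have "t = exec_instr (Add c 2 0) s" unfolding t_def using init by (rule step_code_at)
  then have "regs t = (regs s)(c := n)" "inp t = inp s" "outp t = outp s" "pc t = ?l"
    using fixed[OF A] by simp_all
  then obtain m u where u: "m \<le> n * (k + 2)" "(step P ^^ m) t = u" "pc u = ?e + 2"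
    "I n (regs u) (inp u) (outp u)"
    using loop[of 0 t] assms(1) upd[OF A] by auto
  have "(step P ^^ Suc m) s = u" using u(2) by (simp add: t_def funpow_Suc_right del: funpow.simps)
  then show "\<exists>m\<le>Suc (n * (k + 2)). \<exists>t. (step P ^^ m) s = t \<and>
      pc t = pc s + length (for_loop c f (pc s)) \<and> I n (regs t) (inp t) (outp t)"
    using u by (intro exI[of _ "Suc m"]) (simp add: for_loop_def)
qed

section \<open>The program\<close>

text \<open>The working registers are 0 to 18. The matrix lies above them, so writing to a working
  register never destroys an entry.\<close>

abbreviation adj_base :: nat where "adj_base \<equiv> 20"

context
  fixes n :: nat and es :: "nat list"
begin

text \<open>In terms of the 0/1 entries of the adjacency matrix, \<open>excess i j n\<close> counts the elements of
  \<open>N(j) - N(i)\<close>, \<open>before i j\<close> is 1 iff \<open>j\<close> precedes \<open>i\<close>, and \<open>uncovered i n\<close> counts the neighbours of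
  \<open>i\<close> that are adjacent to no vertex preceding \<open>i\<close>. For 0/1 values, truncated \<open>1 - x\<close>, \<open>x - y\<close> and
  \<open>x + y - 1\<close> are negation, and-not and conjunction; on arbitrary numbers, \<open>1 - x\<close> tests for 0.\<close>

definition entry :: "nat \<Rightarrow> nat \<Rightarrow> nat" where
  "entry i j = es ! (i * n + j)"

definition excess :: "nat \<Rightarrow> nat \<Rightarrow> nat \<Rightarrow> nat" where
  "excess i j m = (\<Sum>m'<m. entry j m' - entry i m')"

definition before :: "nat \<Rightarrow> nat \<Rightarrow> nat" where
  "before i j = (1 - excess i j n) - (1 - (excess j i n + ((n - j) - (n - i))))"

definition covers :: "nat \<Rightarrow> nat \<Rightarrow> nat \<Rightarrow> nat" where
  "covers i k j = (\<Sum>j'<j. before i j' + entry j' k - 1)"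

definition uncovered :: "nat \<Rightarrow> nat \<Rightarrow> nat" where
  "uncovered i k = (\<Sum>k'<k. entry i k' - covers i k' n)"

definition before_count :: "nat \<Rightarrow> nat \<Rightarrow> nat" where
  "before_count i j = (\<Sum>j'<j. before i j')"

text \<open>The outer double negation turns any positive number into 1. The inner sum is positive if
  no vertex precedes \<open>i\<close>, so that the union would be empty, or if some neighbour is
  uncovered.\<close>

definition keep :: "nat \<Rightarrow> nat" where
  "keep i = 1 - (1 - ((1 - n * before_count i n) + uncovered i n))"

definition ready :: "(nat \<Rightarrow> nat) \<Rightarrow> bool" where
  "ready r \<longleftrightarrow> r 0 = 0 \<and> r 1 = 1 \<and> r 2 = n"

definition stored :: "(nat \<Rightarrow> nat) \<Rightarrow> bool" where
  "stored r \<longleftrightarrow> (\<forall>i<n. \<forall>j<n. r (adj_base + i * n + j) = entry i j)"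

lemma stored_upd [simp]: "a < adj_base \<Longrightarrow> stored (r(a := x)) = stored r"
  by (auto simp: stored_def)

lemma stored_nth:
  "stored (regs s) \<Longrightarrow> i < n \<Longrightarrow> j < n \<Longrightarrow> regs s (adj_base + i * n + j) = entry i j"
  by (simp add: stored_def)

text \<open>Each of the four nested invariants contains the counters of the enclosing loops, which
  inner code must preserve and partly reads, but not the counter of its own loop, as
  \<open>triple_for_loop\<close> requires.\<close>

definition inv_vertex :: "nat \<Rightarrow> asrt" where
  "inv_vertex i r xs ys \<longleftrightarrow> ready r \<and> stored r \<and> r 3 = adj_base + i * n \<and> ys = map keep [0..<i]"

definition inv_column :: "nat \<Rightarrow> nat \<Rightarrow> asrt" where
  "inv_column i k r xs ys \<longleftrightarrow> inv_vertex i r xs ys \<and> r 4 = n - i \<and>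
     r 5 = k * before_count i n \<and> r 6 = uncovered i k"

definition inv_candidate :: "nat \<Rightarrow> nat \<Rightarrow> nat \<Rightarrow> asrt" where
  "inv_candidate i k j r xs ys \<longleftrightarrow> inv_vertex i r xs ys \<and> r 4 = n - i \<and> r 7 = n - k \<and>
     r 5 = k * before_count i n + before_count i j \<and> r 6 = uncovered i k \<and>
     r 8 = covers i k j \<and> r 9 = adj_base + j * n"

definition inv_compare :: "nat \<Rightarrow> nat \<Rightarrow> nat \<Rightarrow> nat \<Rightarrow> asrt" where
  "inv_compare i k j m r xs ys \<longleftrightarrow> inv_candidate i k j r xs ys \<and> r 10 = n - j \<and>
     r 11 = excess i j m \<and> r 12 = excess j i m \<and>
     r 13 = adj_base + i * n + m \<and> r 14 = adj_base + j * n + m"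

lemmas inv_defs = inv_vertex_def inv_column_def inv_candidate_def inv_compare_def ready_def

end

text \<open>Registers 3 and 9 hold the addresses of rows \<open>i\<close> and \<open>j\<close>. The loops over \<open>i\<close>, \<open>k\<close>, \<open>j\<close>, \<open>m\<close> count
  down in registers 4, 7, 10, 15, so the index is \<open>n\<close> minus the counter, and \<open>j < i\<close> iff
  register 10 minus register 4 is positive. Register 5 accumulates \<open>before\<close> in every round of
  \<open>k\<close>, hence \<open>n\<close> times too much, but only its being 0 matters.\<close>

definition compare_rows_code :: code where
  "compare_rows_code = block [Load 16 13, Load 17 14, Sub 18 17 16, Add 11 11 18, Sub 18 16 17,
     Add 12 12 18, Add 13 13 1, Add 14 14 1]"

definition candidate_code :: code where
  "candidate_code = seq (block [Const 11 0, Const 12 0, Add 13 3 0, Add 14 9 0])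
     (seq (for_loop 15 compare_rows_code)
       (block [Sub 18 10 4, Add 12 12 18, Sub 16 1 11, Sub 17 1 12, Sub 18 16 17, Add 5 5 18,
          Add 16 9 2, Sub 16 16 7, Load 16 16, Add 17 18 16, Sub 17 17 1, Add 8 8 17, Add 9 9 2]))"

definition column_code :: code where
  "column_code = seq (block [Const 8 0, Const 9 adj_base])
     (seq (for_loop 10 candidate_code)
       (block [Add 16 3 2, Sub 16 16 7, Load 16 16, Sub 16 16 8, Add 6 6 16]))"

definition vertex_code :: code where
  "vertex_code = seq (block [Const 5 0, Const 6 0])
     (seq (for_loop 7 column_code)
       (block [Sub 16 1 5, Add 16 16 6, Sub 16 1 16, Sub 16 1 16, Print 16, Add 3 3 2]))"

text \<open>The literal summands here and in the next two definitions are block lengths, except that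
  the \<open>+ 2\<close> within each round and the \<open>Suc\<close> are the loop overhead.\<close>

definition cost_candidate :: "nat \<Rightarrow> nat" where
  "cost_candidate n = 4 + (Suc (n * (8 + 2)) + 13)"

definition cost_column :: "nat \<Rightarrow> nat" where
  "cost_column n = 2 + (Suc (n * (cost_candidate n + 2)) + 5)"

definition cost_vertex :: "nat \<Rightarrow> nat" where
  "cost_vertex n = 2 + (Suc (n * (cost_column n + 2)) + 6)"

section \<open>Correctness and running time of the nested loops\<close>

lemma triple_compare_rows_code:
  assumes "i < n" "j < n" "m < n"
  shows "triple (\<lambda>r xs ys. inv_compare n es i k j m r xs ys \<and> r 15 = n - m) compare_rows_code 8
                (\<lambda>r xs ys. inv_compare n es i k j (Suc m) r xs ys \<and> r 15 = n - m)"
  unfolding compare_rows_code_def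
  by (rule triple_block)
    (simp_all add: inv_defs excess_def stored_nth[where es = es, OF _ assms(1,3)] stored_nth[where es = es, OF _ assms(2,3)] Let_def)

lemma triple_candidate_code:
  assumes "i < n" "k < n" "j < n"
  shows "triple (\<lambda>r xs ys. inv_candidate n es i k j r xs ys \<and> r 10 = n - j) candidate_code (cost_candidate n)
                (\<lambda>r xs ys. inv_candidate n es i k (Suc j) r xs ys \<and> r 10 = n - j)"
  unfolding candidate_code_def cost_candidate_def
proof (intro triple_seq)
  \<comment> \<open>The counter holds \<open>n - k\<close> rather than \<open>k\<close>, so the
    program reaches the entry by going back from the end of row \<open>j\<close>.\<close>
  have addr: "adj_base + (j * n + n) - (n - k) = adj_base + j * n + k" using assms(2) by simp
  show "triple (\<lambda>r xs ys. inv_candidate n es i k j r xs ys \<and> r 10 = n - j)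
      (block [Const 11 0, Const 12 0, Add 13 3 0, Add 14 9 0]) 4 (inv_compare n es i k j 0)"
    by (rule triple_block) (auto simp: inv_defs excess_def Let_def)
  show "triple (inv_compare n es i k j 0) (for_loop 15 compare_rows_code) (Suc (n * (8 + 2)))
      (inv_compare n es i k j n)"
    using assms by (intro triple_for_loop[where I = "inv_compare n es i k j"] triple_compare_rows_code) (simp_all add: inv_defs)
  show "triple (inv_compare n es i k j n)
      (block [Sub 18 10 4, Add 12 12 18, Sub 16 1 11, Sub 17 1 12, Sub 18 16 17, Add 5 5 18,
          Add 16 9 2, Sub 16 16 7, Load 16 16, Add 17 18 16, Sub 17 17 1, Add 8 8 17, Add 9 9 2]) 13
      (\<lambda>r xs ys. inv_candidate n es i k (Suc j) r xs ys \<and> r 10 = n - j)"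
    by (rule triple_block)
      (simp_all add: inv_defs before_count_def covers_def before_def addr add.assoc
        stored_nth[where es = es, OF _ assms(3,2), unfolded add.assoc] Let_def)
qed

lemma triple_column_code:
  assumes "i < n" "k < n"
  shows "triple (\<lambda>r xs ys. inv_column n es i k r xs ys \<and> r 7 = n - k) column_code (cost_column n)
                (\<lambda>r xs ys. inv_column n es i (Suc k) r xs ys \<and> r 7 = n - k)"
  unfolding column_code_def cost_column_def
proof (intro triple_seq)
  have addr: "adj_base + (i * n + n) - (n - k) = adj_base + (i * n + k)" using assms(2) by simp
  show "triple (\<lambda>r xs ys. inv_column n es i k r xs ys \<and> r 7 = n - k)
      (block [Const 8 0, Const 9 adj_base]) 2 (inv_candidate n es i k 0)"
    by (rule triple_block) (auto simp: inv_defs before_count_def covers_def Let_def)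
  show "triple (inv_candidate n es i k 0) (for_loop 10 candidate_code)
      (Suc (n * (cost_candidate n + 2))) (inv_candidate n es i k n)"
    using assms by (intro triple_for_loop[where I = "inv_candidate n es i k"] triple_candidate_code) (simp_all add: inv_defs)
  show "triple (inv_candidate n es i k n)
      (block [Add 16 3 2, Sub 16 16 7, Load 16 16, Sub 16 16 8, Add 6 6 16]) 5
      (\<lambda>r xs ys. inv_column n es i (Suc k) r xs ys \<and> r 7 = n - k)"
    by (rule triple_block)
      (simp_all add: inv_defs uncovered_def addr add.assoc
        stored_nth[where es = es, OF _ assms, unfolded add.assoc] Let_def)
qed

lemma triple_vertex_code:
  assumes "i < n"
  shows "triple (\<lambda>r xs ys. inv_vertex n es i r xs ys \<and> r 4 = n - i) vertex_code (cost_vertex n)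
                (\<lambda>r xs ys. inv_vertex n es (Suc i) r xs ys \<and> r 4 = n - i)"
  unfolding vertex_code_def cost_vertex_def
proof (intro triple_seq)
  show "triple (\<lambda>r xs ys. inv_vertex n es i r xs ys \<and> r 4 = n - i)
      (block [Const 5 0, Const 6 0]) 2 (inv_column n es i 0)"
    by (rule triple_block) (auto simp: inv_defs uncovered_def Let_def)
  show "triple (inv_column n es i 0) (for_loop 7 column_code)
      (Suc (n * (cost_column n + 2))) (inv_column n es i n)"
    using assms by (intro triple_for_loop[where I = "inv_column n es i"] triple_column_code) (simp_all add: inv_defs)
  show "triple (inv_column n es i n)
      (block [Sub 16 1 5, Add 16 16 6, Sub 16 1 16, Sub 16 1 16, Print 16, Add 3 3 2]) 6
      (\<lambda>r xs ys. inv_vertex n es (Suc i) r xs ys \<and> r 4 = n - i)"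
    by (rule triple_block) (auto simp: inv_defs keep_def Let_def)
qed

section \<open>Reading the matrix, and the whole program\<close>

definition inv_read :: "nat \<Rightarrow> nat list \<Rightarrow> nat \<Rightarrow> asrt" where
  "inv_read n es k r xs ys \<longleftrightarrow> ready n r \<and> r 3 = adj_base + k \<and> xs = drop k es \<and> ys = [] \<and>
     (\<forall>m<k. r (adj_base + m) = es ! m)"

definition read_entry_code :: code where
  "read_entry_code = block [Read 16, Store 3 16, Add 3 3 1]"

definition cocore_code :: code where
  "cocore_code = seq (block [Const 1 1, Const 3 adj_base])
     (seq (for_loop 4 (for_loop 5 read_entry_code))
       (seq (block [Const 3 adj_base]) (for_loop 4 vertex_code)))"

definition cost_cocore :: "nat \<Rightarrow> nat" where
  "cost_cocore n = 2 + (Suc (n * (Suc (n * (3 + 2)) + 2)) + (1 + Suc (n * (cost_vertex n + 2))))"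

lemma index_less: "i < n \<Longrightarrow> j < n \<Longrightarrow> i * n + j < n * (n::nat)"
proof -
  assume "i < n" "j < n"
  then have "i * n + j < Suc i * n" by simp
  also have "\<dots> \<le> n * n" using \<open>i < n\<close> by (intro mult_le_mono1) simp
  finally show ?thesis .
qed

lemma triple_read_entry_code:
  assumes "k < length es"
  shows "triple (\<lambda>r xs ys. inv_read n es k r xs ys \<and> r 4 = x \<and> r 5 = y) read_entry_code 3
                (\<lambda>r xs ys. inv_read n es (Suc k) r xs ys \<and> r 4 = x \<and> r 5 = y)"
  unfolding read_entry_code_def
  by (rule triple_block)
    (use assms in \<open>auto simp: inv_read_def ready_def less_Suc_eq Let_def
      Cons_nth_drop_Suc[OF assms, symmetric]\<close>)

lemma triple_cocore_code:
  assumes "n > 0" "length es = n * n"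
  shows "triple (\<lambda>r xs ys. r 0 = 0 \<and> r 2 = n \<and> xs = es \<and> ys = []) cocore_code (cost_cocore n)
                (\<lambda>r xs ys. ys = map (keep n es) [0..<n])"
  unfolding cocore_code_def cost_cocore_def
proof (intro triple_seq)
  \<comment> \<open>The index \<open>0 * n\<close> is left unevaluated to match the outer reading
    invariant, \<open>inv_read n es (i * n)\<close>, at \<open>i = 0\<close>.\<close>
  show "triple (\<lambda>r xs ys. r 0 = 0 \<and> r 2 = n \<and> xs = es \<and> ys = [])
     (block [Const 1 1, Const 3 adj_base]) 2 (inv_read n es (0 * n))"
    by (rule triple_block) (auto simp: inv_read_def ready_def Let_def)
  show "triple (inv_read n es (0 * n)) (for_loop 4 (for_loop 5 read_entry_code))
     (Suc (n * (Suc (n * (3 + 2)) + 2))) (inv_read n es (n * n))"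
  proof (rule triple_for_loop)
    fix i assume i: "i < n"
    have "triple (\<lambda>r xs ys. inv_read n es (i * n + 0) r xs ys \<and> r 4 = n - i)
      (for_loop 5 read_entry_code) (Suc (n * (3 + 2)))
      (\<lambda>r xs ys. inv_read n es (i * n + n) r xs ys \<and> r 4 = n - i)"
    proof (rule triple_for_loop)
      fix j assume "j < n"
      then have "i * n + j < length es" using index_less i assms(2) by simp
      from triple_read_entry_code[OF this, of n "n - i" "n - j"]
      show "triple (\<lambda>r xs ys. (inv_read n es (i * n + j) r xs ys \<and> r 4 = n - i) \<and> r 5 = n - j)
         read_entry_code 3
         (\<lambda>r xs ys. (inv_read n es (i * n + Suc j) r xs ys \<and> r 4 = n - i) \<and> r 5 = n - j)"
        by (simp add: conj_assoc)
    qed (use assms in \<open>auto simp: inv_read_def ready_def\<close>)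
    then show "triple (\<lambda>r xs ys. inv_read n es (i * n) r xs ys \<and> r 4 = n - i)
      (for_loop 5 read_entry_code) (Suc (n * (3 + 2)))
      (\<lambda>r xs ys. inv_read n es (Suc i * n) r xs ys \<and> r 4 = n - i)"
      by (simp add: add.commute)
  qed (use assms in \<open>auto simp: inv_read_def ready_def\<close>)
  show "triple (inv_read n es (n * n)) (block [Const 3 adj_base]) 1 (inv_vertex n es 0)"
    by (rule triple_block)
      (auto simp: inv_read_def inv_vertex_def ready_def stored_def entry_def index_less
        add.assoc Let_def)
  have "triple (inv_vertex n es 0) (for_loop 4 vertex_code) (Suc (n * (cost_vertex n + 2)))
     (inv_vertex n es n)"
    using assms by (intro triple_for_loop[where I = "inv_vertex n es"] triple_vertex_code) (simp_all add: inv_defs)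
  then show "triple (inv_vertex n es 0) (for_loop 4 vertex_code) (Suc (n * (cost_vertex n + 2)))
     (\<lambda>r xs ys. ys = map (keep n es) [0..<n])"
    by (rule triple_conseq) (auto simp: inv_vertex_def)
qed

text \<open>The header of four instructions bypasses the loops when the graph is empty, since they
  run their body at least once. Setting register 0 to 1 makes the following jump to the end
  unconditional.\<close>

definition cocore_program :: "instr list" where
  "cocore_program = [Read 2, JumpPos 4 2, Const 0 1, JumpPos (4 + length (cocore_code 4)) 0]
     @ cocore_code 4"

lemma step_funpow_halted: "halted P s \<Longrightarrow> (step P ^^ k) s = s"
  by (induction k) (simp_all add: step_def)

lemma computes_withinI:
  assumes "(step P ^^ m) (init_config xs) = s" "pc s = length P" "outp s = ys" "m \<le> t"
  shows "computes_within P xs ys t"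
proof -
  have h: "halted P s" using assms(2) by (simp add: halted_def)
  have "(step P ^^ (t - m + m)) (init_config xs) = s"
    using step_funpow_halted[OF h] assms(1) by (simp only: funpow_add comp_apply)
  then show ?thesis using assms h by (simp add: computes_within_def)
qed

text \<open>The header takes four steps for \<open>n = 0\<close> and two otherwise; the summand 4
  covers both.\<close>

lemma computes_within_cocore_program:
  assumes "length es = n * n"
  shows "computes_within cocore_program (n # es) (map (keep n es) [0..<n]) (4 + cost_cocore n)"
proof (cases "n = 0")
  case True
  have "(step cocore_program ^^ 4) (init_config (n # es)) =
      \<lparr>pc = length cocore_program, regs = (\<lambda>_. 0)(0 := 1), inp = es, outp = []\<rparr>"
    using True
    by (simp add: cocore_program_def step_def halted_def init_config_def eval_nat_numeral fun_eq_iff)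
  then show ?thesis by (rule computes_withinI) (simp_all add: True)
next
  case False
  define s where "s = (step cocore_program ^^ 2) (init_config (n # es))"
  have s: "s = \<lparr>pc = 4, regs = (\<lambda>_. 0)(2 := n), inp = es, outp = []\<rparr>"
    using False
    by (simp add: s_def cocore_program_def step_def halted_def init_config_def eval_nat_numeral)
  have "code_at cocore_program (pc s) (cocore_code (pc s))"
    unfolding code_at_def
    by (rule exI[of _ "[Read 2, JumpPos 4 2, Const 0 1, JumpPos (4 + length (cocore_code 4)) 0]"],
        rule exI[of _ "[]"]) (simp add: s cocore_program_def)
  moreover have "regs s 0 = 0 \<and> regs s 2 = n \<and> inp s = es \<and> outp s = []"
    by (simp add: s)
  ultimately obtain m t where t: "m \<le> cost_cocore n" "(step cocore_program ^^ m) s = t"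
    "pc t = pc s + length (cocore_code (pc s))" "outp t = map (keep n es) [0..<n]"
    using tripleE[OF triple_cocore_code[OF _ assms]] False by blast
  have "(step cocore_program ^^ (m + 2)) (init_config (n # es)) = t"
    using t(2) by (simp only: funpow_add comp_apply s_def)
  then show ?thesis
    by (rule computes_withinI) (use t s in \<open>simp_all add: cocore_program_def\<close>)
qed

section \<open>Correctness of the output\<close>

lemma length_concat_uniform:
  "\<forall>xs\<in>set xss. length xs = n \<Longrightarrow> length (concat xss) = length xss * n"
  by (induction xss) auto

lemma nth_concat_uniform:
  assumes "\<forall>xs\<in>set xss. length xs = n" "i < length xss" "j < n"
  shows "concat xss ! (i * n + j) = xss ! i ! j"
  using assms
proof (induction xss arbitrary: i)
  case (Cons xs xss)
  then show ?case by (cases i) (simp_all add: nth_append)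
qed simp

context
  fixes n :: nat and es :: "nat list"
begin

lemma excess_eq_0_iff: "excess n es i j n = 0 \<longleftrightarrow> (\<forall>m<n. entry n es j m \<le> entry n es i m)"
  by (auto simp: excess_def)

text \<open>In this range \<open>(n - j) - (n - i)\<close> equals the truncated
  \<open>i - j\<close>, which is positive iff \<open>j < i\<close>.\<close>

lemma before_eq:
  assumes "i < n" "j < n"
  shows "before n es i j = of_bool (excess n es i j n = 0 \<and> (excess n es j i n = 0 \<longrightarrow> j < i))"
  using assms by (auto simp: before_def)

lemma covers_pos_iff:
  assumes "i < n" "\<And>j. j < n \<Longrightarrow> entry n es j k \<le> 1"
  shows "covers n es i k n > 0 \<longleftrightarrow> (\<exists>j<n. before n es i j > 0 \<and> entry n es j k > 0)"
proof -
  have "before n es i j + entry n es j k - 1 = 0 \<longleftrightarrow> \<not> (before n es i j > 0 \<and> entry n es j k > 0)"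
    if "j < n" for j
    using assms(1) assms(2)[OF that] that by (auto simp: before_eq)
  then have "covers n es i k n = 0 \<longleftrightarrow> \<not> (\<exists>j<n. before n es i j > 0 \<and> entry n es j k > 0)"
    unfolding covers_def by (simp add: Ball_def del: diff_is_0_eq One_nat_def)
  then show ?thesis by auto
qed

lemma keep_eq:
  assumes "i < n" and bit: "\<And>j k. j < n \<Longrightarrow> k < n \<Longrightarrow> entry n es j k \<le> 1"
  shows "keep n es i = of_bool (\<not> ((\<exists>j<n. before n es i j > 0) \<and>
    (\<forall>k<n. entry n es i k > 0 \<longrightarrow> (\<exists>j<n. before n es i j > 0 \<and> entry n es j k > 0))))"
proof -
  have "uncovered n es i n = 0 \<longleftrightarrow> (\<forall>k<n. entry n es i k > 0 \<longrightarrow> covers n es i k n > 0)"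
  proof -
    have "entry n es i k - covers n es i k n = 0 \<longleftrightarrow> (entry n es i k > 0 \<longrightarrow> covers n es i k n > 0)"
      if "k < n" for k
      using bit[OF assms(1) that] by auto
    then show ?thesis unfolding uncovered_def by (simp add: Ball_def del: diff_is_0_eq)
  qed
  moreover have "n * before_count n es i n = 0 \<longleftrightarrow> \<not> (\<exists>j<n. before n es i j > 0)"
    using assms(1) by (auto simp: before_count_def)
  moreover have "keep n es i = of_bool (n * before_count n es i n = 0 \<or> uncovered n es i n > 0)"
    unfolding keep_def by (cases "n * before_count n es i n = 0") auto
  ultimately show ?thesis using covers_pos_iff[OF assms(1)] bit by auto
qed

end

lemma nbh_generated_before_iff:
  "nbh_generated E {x \<in> V. nbh_before E f x u} u \<longleftrightarrow>
     (\<exists>x\<in>V. nbh_before E f x u) \<and>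
     (\<forall>v. (u, v) \<in> E \<longrightarrow> (\<exists>x\<in>V. nbh_before E f x u \<and> (x, v) \<in> E))"
  unfolding nbh_generated_def nbh_before_def by blast

text \<open>The coefficients result from multiplying out the nested costs; degree four reflects the
  four loops.\<close>

lemma poly_cost_cocore: "poly [:9, 14, 15, 20, 10:] n = 4 + cost_cocore n"
  by (simp add: cost_cocore_def cost_vertex_def cost_column_def cost_candidate_def algebra_simps)

lemma computes_within_R_cocore:
  assumes G: "pair_pseudo_graph G" and vs: "distinct vs" "set vs = pverts G"
  shows "\<exists>H. R_cocore H G \<and> computes_within cocore_program (encode_graph vs G)
           (encode_vertices vs H) (4 + cost_cocore (card (pverts G)))"
proof -
  define n where "n = length vs"
  define es where "es = concat (map (\<lambda>u. map (\<lambda>v. if (u, v) \<in> parcs G then 1 else 0) vs) vs :: nat list list)"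
  \<comment> \<open>Ties are broken by the position in \<open>vs\<close>, so
    \<open>nbh_before\<close> becomes the comparison of indices that the program makes.\<close>
  define f where "f = the_inv_into {..<n} ((!) vs)"
  let ?E = "parcs G" and ?V = "pverts G"
  define S where "S = {u \<in> ?V. \<not> nbh_generated ?E {x \<in> ?V. nbh_before ?E f x u} u}"
  let ?H = "\<lparr>pverts = S, parcs = ?E \<inter> S \<times> S\<rparr>"
  have len: "length es = n * n" by (simp add: es_def n_def length_concat_uniform[where n = "length vs"])
  have entry: "entry n es i j = of_bool ((vs ! i, vs ! j) \<in> ?E)" if "i < n" "j < n" for i j
    using that unfolding entry_def es_def n_def by (subst nth_concat_uniform) auto
  have inj: "inj_on ((!) vs) {..<n}" using vs(1) by (simp add: n_def inj_on_nth)
  have V: "?V = (!) vs ` {..<n}" using vs(2) by (auto simp: n_def set_conv_nth)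
  have f: "f (vs ! i) = i" if "i < n" for i
    using that inj unfolding f_def by (simp add: the_inv_into_f_f)
  have arcV: "u \<in> ?V \<and> v \<in> ?V" if "(u, v) \<in> ?E" for u v
    using that pair_wf_digraph.wellformed'[of G u v] G
    by (simp add: pair_pseudo_graph_def pair_fin_digraph_def)
  \<comment> \<open>Comparing matrix rows suffices because all edges end in vertices, and every
    vertex occurs in \<open>vs\<close>.\<close>
  have nbh: "?E `` {vs ! j} \<subseteq> ?E `` {vs ! i} \<longleftrightarrow> excess n es i j n = 0" if "i < n" "j < n" for i j
  proof -
    have "?E `` {vs ! j} \<subseteq> ?E `` {vs ! i} \<longleftrightarrow>
        (\<forall>v\<in>?V. (vs ! j, v) \<in> ?E \<longrightarrow> (vs ! i, v) \<in> ?E)"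
      using arcV by blast
    then show ?thesis using that by (auto simp: V excess_eq_0_iff entry)
  qed
  have before: "before n es i j > 0 \<longleftrightarrow> nbh_before ?E f (vs ! j) (vs ! i)" if "i < n" "j < n" for i j
    using that by (simp add: before_eq nbh_before_def nbh f)
  have keep: "keep n es i = of_bool (vs ! i \<in> S)" if i: "i < n" for i
  proof -
    have "(\<forall>v. (vs ! i, v) \<in> ?E \<longrightarrow> P v) \<longleftrightarrow> (\<forall>k<n. (vs ! i, vs ! k) \<in> ?E \<longrightarrow> P (vs ! k))" for P
      using arcV[of "vs ! i"] unfolding V by blast
    then have "nbh_generated ?E {x \<in> ?V. nbh_before ?E f x (vs ! i)} (vs ! i) \<longleftrightarrow>
      (\<exists>j<n. nbh_before ?E f (vs ! j) (vs ! i)) \<and>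
      (\<forall>k<n. (vs ! i, vs ! k) \<in> ?E \<longrightarrow>
         (\<exists>j<n. nbh_before ?E f (vs ! j) (vs ! i) \<and> (vs ! j, vs ! k) \<in> ?E))"
      unfolding nbh_generated_before_iff by (simp add: V Bex_def lessThan_def)
    moreover have "vs ! i \<in> ?V" using i V by blast
    moreover have "keep n es i = of_bool (\<not> ((\<exists>j<n. nbh_before ?E f (vs ! j) (vs ! i)) \<and>
      (\<forall>k<n. (vs ! i, vs ! k) \<in> ?E \<longrightarrow>
         (\<exists>j<n. nbh_before ?E f (vs ! j) (vs ! i) \<and> (vs ! j, vs ! k) \<in> ?E))))"
      using i by (simp add: keep_eq entry before cong: conj_cong)
    ultimately show ?thesis by (simp add: S_def)
  qed
  have "map (keep n es) [0..<n] = encode_vertices vs ?H"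
    by (rule nth_equalityI) (simp_all add: encode_vertices_def n_def[symmetric] keep)
  moreover have "n # es = encode_graph vs G" by (simp add: encode_graph_def n_def es_def)
  moreover have "card ?V = n" using vs distinct_card by (metis n_def)
  moreover have "R_cocore ?H G"
    unfolding S_def using G by (rule R_cocore_irredundant) (simp add: V f inj_on_def)
  ultimately show ?thesis using computes_within_cocore_program[OF len] by metis
qed

theorem mainTheorem10:
  shows "\<exists>(P :: instr list) (p :: nat poly).
           \<forall>(G :: nat pair_pre_digraph) (vs :: nat list).
             pair_pseudo_graph G \<and> distinct vs \<and> set vs = pverts G \<longrightarrow>
             (\<exists>H. R_cocore H G \<and>
                  computes_within P (encode_graph vs G) (encode_vertices vs H)
                    (poly p (card (pverts G))))"
  using computes_within_R_cocore poly_cost_cocore by metis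

end
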